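(* Let $q\ge 1$ and $d\ge 2$ be integers and let $C\subset Q_q^d$ be a code with code distance $2$. Then there exist an integer $q'$ with $q\leq q'\leq q^{d-1}$ and an $MDS(1,d,q')$ code $M$ such that $C\subset M\subset Q_{q'}^d$.
   Context: $Q_q=\{0,\dots,q-1\}$, and $Q_q^d$ is equipped with the Hamming distance $\rho$. A subset $C\subseteq Q_q^d$ is a code with distance $2$ if $\min\{\rho(x,y): x,y\in C,\ x\ne y\}=2$. A subset $M\subseteq Q_q^d$ is an $MDS(1,d,q)$ code if $|M\cap\Gamma|=1$ for every line $\Gamma$ of $Q_q^d$ obtained by fixing $d-1$ coordinates and letting the remaining coordinate range over $Q_q$ (equivalently, $M$ is the graph of a $(d-1)$-dimensional Latin hypercube of order $q$). For $q\le q'$ we regard $Q_q\subseteq Q_{q'}$ and hence $Q_q^d\subseteq Q_{q'}^d$. *)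

theory Defs
  imports Main "HOL-Library.FuncSet"
begin

text \<open>
  Points of the hypercube are extensional functions on \<open>{..<d}\<close>, so that
  \<open>cube q d \<subseteq> cube q' d\<close> is literal set inclusion whenever \<open>q \<le> q'\<close>.
\<close>

definition cube :: "nat \<Rightarrow> nat \<Rightarrow> (nat \<Rightarrow> nat) set" where
  "cube q d = {..<d} \<rightarrow>\<^sub>E {..<q}"

definition hamming_dist :: "nat \<Rightarrow> (nat \<Rightarrow> nat) \<Rightarrow> (nat \<Rightarrow> nat) \<Rightarrow> nat" where
  "hamming_dist d x y = card {i \<in> {..<d}. x i \<noteq> y i}"

definition pair_dists :: "nat \<Rightarrow> (nat \<Rightarrow> nat) set \<Rightarrow> nat set" where
  "pair_dists d C = {hamming_dist d x y | x y. x \<in> C \<and> y \<in> C \<and> x \<noteq> y}"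

text \<open>
  The minimum is required to exist: \<open>Min\<close> of the empty set is an unspecified value,
  so codes with fewer than two elements are excluded explicitly.
\<close>

definition code_with_distance :: "nat \<Rightarrow> nat \<Rightarrow> nat \<Rightarrow> (nat \<Rightarrow> nat) set \<Rightarrow> bool" where
  "code_with_distance k d q C \<longleftrightarrow>
     C \<subseteq> cube q d \<and> pair_dists d C \<noteq> {} \<and> Min (pair_dists d C) = k"

definition line :: "nat \<Rightarrow> nat \<Rightarrow> nat \<Rightarrow> (nat \<Rightarrow> nat) \<Rightarrow> (nat \<Rightarrow> nat) set" where
  "line d q i a = {x \<in> cube q d. \<forall>j<d. j \<noteq> i \<longrightarrow> x j = a j}"

definition lines :: "nat \<Rightarrow> nat \<Rightarrow> (nat \<Rightarrow> nat) set set" where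
  "lines d q = {line d q i a | i a. i < d \<and> a \<in> cube q d}"

definition MDS1 :: "nat \<Rightarrow> nat \<Rightarrow> (nat \<Rightarrow> nat) set \<Rightarrow> bool" where
  "MDS1 d q M \<longleftrightarrow> M \<subseteq> cube q d \<and> (\<forall>\<Gamma>\<in>lines d q. card (M \<inter> \<Gamma>) = 1)"

end

theory Submission
  imports Defs
begin

text \<open>
  Induction on the dimension, gaining a factor \<open>q\<close> in the order at each step; in dimension 2 a
  partial permutation is completed to a permutation.  For the step, slice the code by its last
  coordinate \<open>c\<close> and embed each slice, a code of distance 2 in one dimension less, into the graph
  of a Latin hypercube \<open>F\<^sub>c\<close> of order \<open>r\<close>.  The difference of the last coordinate and \<open>F\<^sub>c\<close> is a
  Latin hypercube \<open>g\<^sub>c\<close> that vanishes on slice \<open>c\<close>.  Write the elements of the larger alphabet as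
  pairs \<open>(a, t)\<close> with \<open>a < r\<close> and \<open>t < q\<close>, and send the point \<open>(a\<^sub>j, t\<^sub>j)\<^sub>j\<close> to the symbol
  \<open>(g\<^sub>c(a), c)\<close> where \<open>c = s(a) + \<Sum>j. t\<^sub>j\<close> and \<open>s(a)\<close> is the value prescribed by the code at
  \<open>a\<close>, if any, and arbitrary otherwise.  Changing only \<open>t\<^sub>j\<close> changes \<open>c\<close>, and changing \<open>a\<^sub>j\<close>
  changes \<open>c\<close> or the value of \<open>g\<^sub>c\<close>; so this is a Latin hypercube, and at \<open>t = 0\<close> it takes the
  value \<open>(0, s(a))\<close> prescribed by the code.
\<close>

text \<open>Slices in the induction may have at most one point. This form admits them, whereas
  \<open>code_with_distance 2\<close> does not.\<close>

definition separated :: "nat \<Rightarrow> (nat \<Rightarrow> nat) set \<Rightarrow> bool" where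
  "separated d C \<longleftrightarrow> (\<forall>x\<in>C. \<forall>i<d. \<forall>v. x(i := v) \<in> C \<longrightarrow> v = x i)"

text \<open>Injectivity along each line is enough: on a finite alphabet it gives
  bijectivity.\<close>

definition latin :: "nat \<Rightarrow> nat \<Rightarrow> ((nat \<Rightarrow> nat) \<Rightarrow> nat) \<Rightarrow> bool" where
  "latin r n F \<longleftrightarrow> (\<forall>x\<in>cube r n. F x < r \<and> (\<forall>i<n. \<forall>v<r. F (x(i := v)) = F x \<longrightarrow> v = x i))"

lemma separatedD: "separated d C \<Longrightarrow> x \<in> C \<Longrightarrow> i < d \<Longrightarrow> x(i := v) \<in> C \<Longrightarrow> v = x i"
  unfolding separated_def by blast

lemma latin_less: "latin r n F \<Longrightarrow> x \<in> cube r n \<Longrightarrow> F x < r"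
  unfolding latin_def by blast

lemma latinD: "latin r n F \<Longrightarrow> x \<in> cube r n \<Longrightarrow> i < n \<Longrightarrow> v < r \<Longrightarrow> F (x(i := v)) = F x \<Longrightarrow> v = x i"
  unfolding latin_def by blast

section \<open>Points of the cube\<close>

lemma cube_iff: "x \<in> cube q d \<longleftrightarrow> (\<forall>i. if i < d then x i < q else x i = undefined)"
  unfolding cube_def PiE_iff extensional_def by auto

lemma cube_less: "x \<in> cube q d \<Longrightarrow> i < d \<Longrightarrow> x i < q"
  unfolding cube_def by (auto dest: PiE_mem)

lemma cube_eqI:
  assumes "x \<in> cube q d" "y \<in> cube q d" "\<And>j. j < d \<Longrightarrow> x j = y j"
  shows "x = y"
  using assms unfolding cube_def by (intro PiE_ext[of x "{..<d}" _ y]) auto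

lemma cube_mono: "q \<le> r \<Longrightarrow> cube q d \<subseteq> cube r d"
  unfolding cube_iff subset_iff by (auto intro: less_le_trans)

lemma cube_upd: "x \<in> cube q d \<Longrightarrow> i < d \<Longrightarrow> v < q \<Longrightarrow> x(i := v) \<in> cube q d"
  unfolding cube_iff by auto

lemma cube_drop: "x \<in> cube q (Suc n) \<Longrightarrow> x(n := undefined) \<in> cube q n"
  unfolding cube_iff by (auto simp: less_Suc_eq split: if_splits)

section \<open>Separation, Latin graphs and completion of injections\<close>

lemma separated_if_code_distance_2:
  assumes "code_with_distance 2 d q C"
  shows "separated d C"
  unfolding separated_def
proof (intro ballI allI impI, rule ccontr)
  fix x i v assume x: "x \<in> C" "i < d" "x(i := v) \<in> C" and ne: "v \<noteq> x i"
  \<comment> \<open>Finiteness of the set of distances lets \<open>Min\<close> bound each of them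
    from below.\<close>
  have "hamming_dist d y z \<le> d" for y z
    unfolding hamming_dist_def using card_mono[of "{..<d}" "{j \<in> {..<d}. y j \<noteq> z j}"] by auto
  hence "pair_dists d C \<subseteq> {..d}" unfolding pair_dists_def by blast
  hence fin: "finite (pair_dists d C)" by (rule finite_subset) simp
  have "{j \<in> {..<d}. x j \<noteq> (x(i := v)) j} = {i}" using x ne by auto
  hence "hamming_dist d x (x(i := v)) = 1" unfolding hamming_dist_def by simp
  moreover have "x \<noteq> x(i := v)" using ne by (metis fun_upd_same)
  ultimately have "1 \<in> pair_dists d C" unfolding pair_dists_def using x by force
  hence "Min (pair_dists d C) \<le> 1" using fin by simp
  thus False using assms unfolding code_with_distance_def by simp
qed

lemma latin_graph_MDS1:
  assumes F: "latin r n F"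
  shows "MDS1 (Suc n) r {x \<in> cube r (Suc n). F (x(n := undefined)) = x n}" (is "MDS1 _ _ ?M")
  unfolding MDS1_def
proof (intro conjI ballI)
  show "?M \<subseteq> cube r (Suc n)" by blast
  fix \<Gamma> assume "\<Gamma> \<in> lines (Suc n) r"
  then obtain i a where i: "i < Suc n" and a: "a \<in> cube r (Suc n)" and G: "\<Gamma> = line (Suc n) r i a"
    unfolding lines_def by blast
  have \<Gamma>: "\<Gamma> = (\<lambda>v. a(i := v)) ` {..<r}"
  proof (intro equalityI subsetI)
    fix x assume "x \<in> \<Gamma>"
    hence x: "x \<in> cube r (Suc n)" "\<forall>j<Suc n. j \<noteq> i \<longrightarrow> x j = a j"
      unfolding G line_def by auto
    have xi: "x i < r" using cube_less[OF x(1) i] .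
    moreover have "x = a(i := x i)"
      by (rule cube_eqI[OF x(1) cube_upd[OF a i xi]]) (use x(2) in simp)
    ultimately show "x \<in> (\<lambda>v. a(i := v)) ` {..<r}" by blast
  next
    fix x assume "x \<in> (\<lambda>v. a(i := v)) ` {..<r}"
    thus "x \<in> \<Gamma>" unfolding G line_def using cube_upd[OF a i] by auto
  qed
  have "\<exists>!v. v < r \<and> a(i := v) \<in> ?M"
  proof (cases "i = n")
    case True
    let ?w = "F (a(n := undefined))"
    have "?w < r" using latin_less[OF F cube_drop[OF a]] .
    moreover have "v < r \<and> a(i := v) \<in> ?M \<longleftrightarrow> v < r \<and> v = ?w" for v
      using True cube_upd[OF a i] by auto
    ultimately show ?thesis by auto
  next
    case False
    hence "i < n" using i by simp
    let ?b = "a(n := undefined)"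
    have b: "?b(i := v) \<in> cube r n" if "v < r" for v
      using cube_upd[OF cube_drop[OF a] \<open>i < n\<close> that] .
    \<comment> \<open>Along a direction \<open>i < n\<close>, \<open>?h\<close> is an injective,
      hence bijective, self-map of the alphabet, so it takes the value \<open>a n\<close> exactly
      once.\<close>
    let ?h = "\<lambda>v. F (?b(i := v))"
    have inj: "inj_on ?h {..<r}"
    proof (rule inj_onI)
      fix v w assume "v \<in> {..<r}" "w \<in> {..<r}" "?h v = ?h w"
      thus "v = w" using latinD[OF F b[of w] \<open>i < n\<close>, of v] by simp
    qed
    moreover have "?h ` {..<r} \<subseteq> {..<r}" using latin_less[OF F b] by auto
    ultimately have "?h ` {..<r} = {..<r}" by (intro endo_inj_surj) auto
    moreover have "a n < r" using cube_less[OF a] by simp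
    ultimately have "a n \<in> ?h ` {..<r}" by blast
    then obtain w where w: "w < r" "?h w = a n" by auto
    have mem_iff: "v < r \<and> a(i := v) \<in> ?M \<longleftrightarrow> v < r \<and> ?h v = a n" for v
      using False cube_upd[OF a i] by (auto simp: fun_upd_twist)
    have "v = w" if "v < r \<and> ?h v = a n" for v
      using inj_onD[OF inj, of v w] w that by simp
    thus ?thesis unfolding mem_iff using w by (intro ex1I[of _ w] conjI)
  qed
  then obtain w where w: "w < r" "a(i := w) \<in> ?M" "\<And>v. v < r \<Longrightarrow> a(i := v) \<in> ?M \<Longrightarrow> v = w"
    by blast
  hence "?M \<inter> \<Gamma> = {a(i := w)}" unfolding \<Gamma> by blast
  thus "card (?M \<inter> \<Gamma>) = 1" by simp
qed

text \<open>The complements of domain and image have equal size, so any bijection between them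
  completes \<open>f\<close>.\<close>

lemma partial_injection_extends:
  assumes "finite B" "A \<subseteq> B" "inj_on f A" "f ` A \<subseteq> B"
  obtains g where "bij_betw g B B" "\<And>x. x \<in> A \<Longrightarrow> g x = f x"
proof -
  have "card (B - A) = card (B - f ` A)"
    using assms by (simp add: card_Diff_subset finite_subset card_image)
  then obtain e where e: "bij_betw e (B - A) (B - f ` A)"
    using assms finite_same_card_bij by (metis finite_Diff)
  let ?g = "\<lambda>x. if x \<in> A then f x else e x"
  have "bij_betw ?g A (f ` A)" using assms(3) by (simp add: bij_betw_def inj_on_def)
  moreover have "bij_betw ?g (B - A) (B - f ` A)" using e
    by (rule bij_betw_cong[THEN iffD1, rotated]) simp
  ultimately have "bij_betw ?g (A \<union> (B - A)) (f ` A \<union> (B - f ` A))"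
    by (rule bij_betw_combine) auto
  moreover have "A \<union> (B - A) = B" "f ` A \<union> (B - f ` A) = B" using assms by auto
  ultimately show ?thesis using that by simp
qed

section \<open>Differences modulo \<open>r\<close>\<close>

lemma add_mod_cancel:
  fixes v w k r :: nat
  assumes "(v + k) mod r = (w + k) mod r" "v < r" "w < r"
  shows "v = w"
proof -
  have "(int v + int k) mod int r = (int w + int k) mod int r"
    using assms(1) by (metis of_nat_add of_nat_mod)
  hence "int v mod int r = int w mod int r" by (metis add_diff_cancel_right' mod_diff_left_eq)
  thus ?thesis using assms by simp
qed

lemma sub_mod_cancel:
  fixes v w u r :: nat
  assumes "(u + (r - v)) mod r = (u + (r - w)) mod r" "v < r" "w < r"
  shows "v = w"
proof -
  \<comment> \<open>The reflection \<open>r - 1 - v\<close> stays below \<open>r\<close>, while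
    \<open>r - v\<close> reaches \<open>r\<close> at \<open>v = 0\<close>; the missing unit moves
    into \<open>Suc u\<close>.\<close>
  have "((r - 1 - v) + Suc u) mod r = ((r - 1 - w) + Suc u) mod r"
    using assms by (simp add: Suc_diff_Suc add.commute)
  hence "r - 1 - v = r - 1 - w" by (rule add_mod_cancel) (use assms in auto)
  thus ?thesis using assms by linarith
qed

text \<open>Adding \<open>r - F\<close> subtracts \<open>F\<close> modulo \<open>r\<close> without
  truncation, since \<open>F\<close> is below \<open>r\<close> on the cube. Within the cube the
  result is 0 exactly on the graph of \<open>F\<close>.\<close>

lemma latin_difference:
  assumes F: "latin r n F"
  shows "latin r (Suc n) (\<lambda>x. (x n + (r - F (x(n := undefined)))) mod r)"
  unfolding latin_def
proof (intro ballI conjI allI impI)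
  fix x assume x: "x \<in> cube r (Suc n)"
  have xn: "x n < r" using cube_less[OF x] by simp
  thus "(x n + (r - F (x(n := undefined)))) mod r < r" by simp
  fix i v assume i: "i < Suc n" and v: "v < r"
    and eq: "((x(i := v)) n + (r - F ((x(i := v))(n := undefined)))) mod r
           = (x n + (r - F (x(n := undefined)))) mod r"
  note y = cube_drop[OF x]
  show "v = x i"
  proof (cases "i = n")
    case True
    thus ?thesis using eq v xn add_mod_cancel[of v _ r "x n"] by simp
  next
    case False
    hence "i < n" using i by simp
    let ?y = "x(n := undefined)"
    have "(x(i := v))(n := undefined) = ?y(i := v)" using False by (simp add: fun_upd_twist)
    hence "(x n + (r - F (?y(i := v)))) mod r = (x n + (r - F ?y)) mod r"
      using eq False by simp
    hence "F (?y(i := v)) = F ?y"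
      using latin_less[OF F cube_upd[OF y \<open>i < n\<close> v]] latin_less[OF F y] by (rule sub_mod_cancel)
    thus ?thesis using latinD[OF F y \<open>i < n\<close> v] False by simp
  qed
qed

section \<open>Codes in the plane\<close>

lemma embed_plane:
  assumes C: "C \<subseteq> cube q 2" and sep: "separated 2 C"
  obtains F where "latin q 1 F" "\<And>x. x \<in> C \<Longrightarrow> F (x(1 := undefined)) = x 1"
proof -
  \<comment> \<open>Either coordinate determines the other, so \<open>C\<close> is the graph of a
    partial injection.\<close>
  have agree: "x = y" if "x \<in> C" "y \<in> C" "x 0 = y 0 \<or> x 1 = y 1" for x y
  proof -
    have mem: "x \<in> cube q 2" "y \<in> cube q 2" using C that by auto
    have eq: "x = y(0 := x 0, 1 := x 1)"
      by (rule cube_eqI[OF mem(1)])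
        (auto intro!: cube_upd mem cube_less[OF mem(1)] simp: less_2_cases_iff)
    show ?thesis
    proof (cases "x 0 = y 0")
      case True
      hence *: "x = y(1 := x 1)" using eq by (metis fun_upd_triv)
      hence "x 1 = y 1" using separatedD[OF sep that(2), of 1] that(1)
        by (metis one_less_numeral_iff semiring_norm(76))
      thus ?thesis using * by (metis fun_upd_triv)
    next
      case False
      hence *: "x = y(0 := x 0)" using eq that(3) by (metis fun_upd_triv fun_upd_twist zero_neq_one)
      hence "x 0 = y 0" using separatedD[OF sep that(2), of 0] that(1) by (metis zero_less_numeral)
      thus ?thesis using False by simp
    qed
  qed
  have bd: "x 0 < q" "x 1 < q" if "x \<in> C" for x
    using cube_less[OF subsetD[OF C that]] by simp_all
  \<comment> \<open>By \<open>agree\<close> the choice is unique at first coordinates of code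
    points; elsewhere \<open>f\<close> is arbitrary and \<open>g\<close> need not follow it.\<close>
  define f where "f k = (SOME x. x \<in> C \<and> x 0 = k) 1" for k
  have f: "f (x 0) = x 1" if "x \<in> C" for x
  proof -
    have "(SOME y. y \<in> C \<and> y 0 = x 0) = x"
      by (rule some_equality) (use that agree in auto)
    thus ?thesis unfolding f_def by simp
  qed
  have "inj_on f ((\<lambda>x. x 0) ` C)"
  proof (rule inj_onI, clarify)
    fix x y assume "x \<in> C" "y \<in> C" "f (x 0) = f (y 0)"
    thus "x 0 = y 0" using agree[of x y] f by simp
  qed
  moreover have "(\<lambda>x. x 0) ` C \<subseteq> {..<q}" "f ` (\<lambda>x. x 0) ` C \<subseteq> {..<q}"
    using bd f by auto
  ultimately obtain g where g: "bij_betw g {..<q} {..<q}"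
    and gf: "\<And>k. k \<in> (\<lambda>x. x 0) ` C \<Longrightarrow> g k = f k"
    using partial_injection_extends[of "{..<q}"] by (metis finite_lessThan)
  have "latin q 1 (\<lambda>x. g (x 0))"
    unfolding latin_def
  proof (intro ballI conjI allI impI)
    fix x assume x: "x \<in> cube q 1"
    have x0: "x 0 < q" using cube_less[OF x] by simp
    thus "g (x 0) < q" using bij_betwE[OF g] by simp
    fix i v :: nat assume "i < 1" "v < q" "g ((x(i := v)) 0) = g (x 0)"
    thus "v = x i" using inj_onD[OF bij_betw_imp_inj_on[OF g], of v "x 0"] x0 by simp
  qed
  moreover have "g ((x(1 := undefined)) 0) = x 1" if "x \<in> C" for x
    using gf f that by simp
  ultimately show ?thesis by (rule that)
qed

section \<open>The product construction\<close>

lemma sum_upd: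
  fixes x :: "nat \<Rightarrow> nat"
  assumes "i < n"
  shows "(\<Sum>j<n. h ((x(i := v)) j)) = h v + (\<Sum>j\<in>{..<n} - {i}. h (x j))"
proof -
  have "(\<Sum>j<n. h ((x(i := v)) j)) = h ((x(i := v)) i) + (\<Sum>j\<in>{..<n} - {i}. h ((x(i := v)) j))"
    by (rule sum.remove) (use assms in simp_all)
  also have "(\<Sum>j\<in>{..<n} - {i}. h ((x(i := v)) j)) = (\<Sum>j\<in>{..<n} - {i}. h (x j))"
    by (rule sum.cong) simp_all
  finally show ?thesis by simp
qed

text \<open>The pair \<open>(a, t)\<close> is coded as \<open>a + r * t\<close> in arguments, but
  the value \<open>(b, c)\<close> as \<open>c + q * b\<close>. Thus arguments with
  \<open>t = 0\<close> and values with \<open>b = 0\<close> keep their original symbols.\<close>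

lemma latin_product:
  fixes s :: "(nat \<Rightarrow> nat) \<Rightarrow> nat"
  assumes g: "\<And>c. c < q \<Longrightarrow> latin r n (g c)" and "0 < q" "0 < r"
  defines "low x \<equiv> (\<lambda>i\<in>{..<n}. x i mod r)"
  defines "c x \<equiv> ((\<Sum>j<n. x j div r) + s (low x)) mod q"
  shows "latin (q * r) n (\<lambda>x. c x + q * g (c x) (low x))"
  unfolding latin_def
proof (intro ballI conjI allI impI)
  have c: "c x < q" for x unfolding c_def using \<open>0 < q\<close> by simp
  fix x assume x: "x \<in> cube (q * r) n"
  have low: "low x \<in> cube r n" for x unfolding low_def cube_iff using \<open>0 < r\<close> by simp
  have "g (c x) (low x) \<le> r - 1" using latin_less[OF g[OF c] low, of x x] by linarith
  hence "q * g (c x) (low x) \<le> q * (r - 1)" by simp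
  hence "c x + q * g (c x) (low x) < q + q * (r - 1)" using c[of x] by linarith
  also have "\<dots> = q * r" using \<open>0 < r\<close> by (cases r) auto
  finally show "c x + q * g (c x) (low x) < q * r" .
  fix i v assume i: "i < n" and v: "v < q * r"
    and eq: "c (x(i := v)) + q * g (c (x(i := v))) (low (x(i := v))) = c x + q * g (c x) (low x)"
  \<comment> \<open>Reduction modulo \<open>q\<close> recovers the low digit \<open>c\<close>; both
    points then use the same \<open>g (c x)\<close>.\<close>
  have ceq: "c (x(i := v)) = c x"
    using arg_cong[OF eq, of "\<lambda>k. k mod q"] c by simp
  have geq: "g (c x) (low (x(i := v))) = g (c x) (low x)"
    using eq ceq \<open>0 < q\<close> by simp
  have lowupd: "low (x(i := v)) = (low x)(i := v mod r)"
    unfolding low_def using i by (auto simp: fun_eq_iff)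
  have m: "v mod r = x i mod r"
    using latinD[OF g[OF c[of x]] low[of x] i, of "v mod r"] geq lowupd i \<open>0 < r\<close>
    by (simp add: low_def)
  hence leq: "low (x(i := v)) = low x" unfolding lowupd using i
    by (auto simp: fun_eq_iff low_def)
  \<comment> \<open>As the low parts agree, so do the \<open>s\<close> terms, and \<open>c\<close>
    can differ only through the high digit at \<open>i\<close>.\<close>
  let ?S = "(\<Sum>j\<in>{..<n} - {i}. x j div r) + s (low x)"
  have "(v div r + ?S) mod q = (x i div r + ?S) mod q"
    using ceq leq i sum_upd[of i n "\<lambda>k. k div r" x v]
      sum_upd[of i n "\<lambda>k. k div r" x "x i"]
    unfolding c_def by (simp add: add.assoc)
  moreover have "x i < q * r" using cube_less[OF x i] .
  ultimately have "v div r = x i div r"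
    using v by (auto intro: add_mod_cancel less_mult_imp_div_less)
  thus "v = x i" using m by (metis div_mult_mod_eq)
qed

section \<open>Slicing and induction on the dimension\<close>

lemma separated_slice:
  assumes C: "C \<subseteq> cube q (Suc n)" and sep: "separated (Suc n) C"
  shows "separated n {y. y(n := c) \<in> C}"
  unfolding separated_def
proof (intro ballI allI impI)
  fix y i v assume "y \<in> {y. y(n := c) \<in> C}" "i < n" "y(i := v) \<in> {y. y(n := c) \<in> C}"
  thus "v = y i" using separatedD[OF sep, of "y(n := c)" i v] by (simp add: fun_upd_twist)
qed

lemma embed_code:
  assumes "1 \<le> q"
  shows "C \<subseteq> cube q (Suc (Suc n)) \<Longrightarrow> separated (Suc (Suc n)) C \<Longrightarrow>
    \<exists>F. latin (q ^ Suc n) (Suc n) F \<and> (\<forall>x\<in>C. F (x(Suc n := undefined)) = x (Suc n))"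
proof (induction n arbitrary: C)
  case 0
  thus ?case using embed_plane[of C q] by (metis One_nat_def numeral_2_eq_2 power_one_right)
next
  case (Suc n)
  let ?m = "Suc (Suc n)" and ?r = "q ^ Suc n"
  have qr: "q \<le> ?r" "0 < ?r" using assms self_le_power[of q "Suc n"] by auto
  define D where "D c = (\<lambda>x. x(?m := undefined)) ` {x \<in> C. x ?m = c}" for c
  have "D c \<subseteq> cube q ?m" for c
    unfolding D_def using cube_drop Suc.prems(1) by blast
  moreover have "separated ?m (D c)" for c
  proof -
    \<comment> \<open>The right-hand set leaves the value at \<open>?m\<close> free;
      \<open>D c\<close> fixes it to \<open>undefined\<close>, and separation passes to
      subsets.\<close>
    have "D c \<subseteq> {y. y(?m := c) \<in> C}" unfolding D_def by auto
    thus ?thesis using separated_slice[OF Suc.prems, of c] unfolding separated_def by blast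
  qed
  ultimately have "\<forall>c. \<exists>F. latin ?r (Suc n) F \<and> (\<forall>x\<in>D c. F (x(Suc n := undefined)) = x (Suc n))"
    using Suc.IH by blast
  then obtain F where F: "\<And>c. latin ?r (Suc n) (F c)"
    and FD: "\<And>c x. x \<in> D c \<Longrightarrow> F c (x(Suc n := undefined)) = x (Suc n)"
    by metis
  define g where "g c x = (x (Suc n) + (?r - F c (x(Suc n := undefined)))) mod ?r" for c x
  have g: "latin ?r ?m (g c)" for c
    unfolding g_def by (rule latin_difference[OF F])
  \<comment> \<open>On truncated code points separation makes this choice unique; elsewhere it may
    exceed \<open>q\<close>, which the reduction in \<open>c\<close> absorbs.\<close>
  define s where "s y = (SOME v. y(?m := v) \<in> C)" for y
  define low where "low x = (\<lambda>i\<in>{..<?m}. x i mod ?r)" for x :: "nat \<Rightarrow> nat"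
  define c where "c x = ((\<Sum>j<?m. x j div ?r) + s (low x)) mod q" for x
  define G where "G x = c x + q * g (c x) (low x)" for x
  have "latin (q ^ Suc (Suc n)) ?m G"
    unfolding G_def c_def low_def power_Suc[of q "Suc n"] using assms qr by (intro latin_product g) auto
  moreover have "G (x(?m := undefined)) = x ?m" if x: "x \<in> C" for x
  proof -
    let ?y = "x(?m := undefined)"
    have xq: "x \<in> cube q (Suc ?m)" using Suc.prems(1) x by blast
    have y: "?y \<in> cube ?r ?m" using cube_drop[OF xq] cube_mono[OF qr(1)] by blast
    have less: "?y j < ?r" if "j < ?m" for j using cube_less[OF y that] .
    \<comment> \<open>Code symbols are below \<open>q \<le> ?r\<close>, so all their high digits are
      0.\<close>
    have low: "low ?y = ?y"
      by (rule cube_eqI[of _ ?r ?m]) (use y less qr(2) in \<open>auto simp: low_def cube_iff\<close>)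
    have "?y(?m := x ?m) \<in> C" by (simp only: fun_upd_upd fun_upd_triv x)
    hence "?y(?m := s ?y) \<in> C" unfolding s_def by (rule someI)
    hence "x(?m := s ?y) \<in> C" by (simp only: fun_upd_upd)
    hence "s ?y = x ?m" using separatedD[OF Suc.prems(2) x, of ?m] by simp
    moreover have "x ?m < q" using cube_less[OF xq] by simp
    moreover have "(\<Sum>j<?m. ?y j div ?r) = 0" using less by (intro sum.neutral) auto
    ultimately have c: "c ?y = x ?m" unfolding c_def low by simp
    \<comment> \<open>On its own slice \<open>F\<close> predicts coordinate \<open>Suc n\<close> of
      \<open>?y\<close>, so the difference \<open>g\<close> is 0 and \<open>G\<close> reduces to
      \<open>c\<close>.\<close>
    have "?y \<in> D (x ?m)" unfolding D_def using x by blast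
    hence "g (x ?m) ?y = (?y (Suc n) + (?r - ?y (Suc n))) mod ?r" unfolding g_def by (simp only: FD)
    also have "\<dots> = 0" using less[of "Suc n"] by simp
    finally show ?thesis unfolding G_def low c by simp
  qed
  ultimately show ?case by blast
qed

theorem theorem3:
  fixes q d :: nat and C :: "(nat \<Rightarrow> nat) set"
  assumes "q \<ge> 1" and "d \<ge> 2"
    and "code_with_distance 2 d q C"
  shows "\<exists>q' M. q \<le> q' \<and> q' \<le> q ^ (d - 1) \<and> MDS1 d q' M \<and> C \<subseteq> M \<and> M \<subseteq> cube q' d"
proof -
  obtain n where d: "d = Suc (Suc n)" using assms(2) by (metis Suc_le_D Suc_le_mono numeral_2_eq_2)
  \<comment> \<open>This is \<open>q ^ (d - 1)\<close>: the order attains the upper bound.\<close>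
  let ?r = "q ^ Suc n"
  have C: "C \<subseteq> cube q d" using assms(3) unfolding code_with_distance_def by blast
  have qr: "q \<le> ?r" using assms(1) self_le_power[of q "Suc n"] by auto
  have "separated d C" by (rule separated_if_code_distance_2[OF assms(3)])
  then obtain F where F: "latin ?r (Suc n) F"
    and FC: "\<forall>x\<in>C. F (x(Suc n := undefined)) = x (Suc n)"
    using embed_code[OF assms(1) C[unfolded d]] unfolding d by blast
  let ?M = "{x \<in> cube ?r d. F (x(Suc n := undefined)) = x (Suc n)}"
  have "MDS1 d ?r ?M" using latin_graph_MDS1[OF F] unfolding d .
  moreover have "C \<subseteq> ?M" using C cube_mono[OF qr] FC by blast
  moreover have "?r \<le> q ^ (d - 1)" "?M \<subseteq> cube ?r d" using d by auto
  ultimately show ?thesis using qr by (intro exI[of _ ?r] exI[of _ ?M] conjI)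
qed

end
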